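(* Let $f\in C^{1,1}_{loc}(\mathbb R^n,\mathbb R)$ be convex with a unique minimizer. Let $c_1,c_2>0$, $p_1>2$, $1<p_2<2$. Then for any $x(0)\in\mathbb R^n$, the solution of $$\dot x=-c_1\frac{\nabla f(x)}{\|\nabla f(x)\|^{\frac{p_1-2}{p_1-1}}}-c_2\frac{\nabla f(x)}{\|\nabla f(x)\|^{\frac{p_2-2}{p_2-1}}}$$ exists and is unique for all $t\ge0$.
   Context: $\|\cdot\|$ is the Euclidean norm. $C^{1,1}_{loc}(\mathbb R^n,\mathbb R)$ is the set of continuously differentiable functions with locally Lipschitz continuous gradient. Convention: the right-hand side of the differential equation is defined to be $0$ at points where $\nabla f(x)=0$. *)

theory Defs
  imports "HOL-Analysis.Analysis"
begin

definition gradient :: "('a::real_inner \<Rightarrow> real) \<Rightarrow> 'a \<Rightarrow> 'a"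
  where "gradient f x = (THE D. GDERIV f x :> D)"

definition locally_lipschitz :: "('a::metric_space \<Rightarrow> 'b::metric_space) \<Rightarrow> bool"
  where "locally_lipschitz g \<longleftrightarrow> (\<forall>x. \<exists>r>0. \<exists>L. L-lipschitz_on (cball x r) g)"

definition C11_loc :: "('a::real_inner \<Rightarrow> real) \<Rightarrow> bool"
  where "C11_loc f \<longleftrightarrow>
    (\<forall>x. f differentiable at x) \<and> continuous_on UNIV (gradient f) \<and> locally_lipschitz (gradient f)"

definition flow_rhs ::
    "('a::real_inner \<Rightarrow> real) \<Rightarrow> real \<Rightarrow> real \<Rightarrow> real \<Rightarrow> real \<Rightarrow> 'a \<Rightarrow> 'a"
  where "flow_rhs f c1 c2 p1 p2 x =
    (if gradient f x = 0 then 0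
     else - (c1 *\<^sub>R (gradient f x /\<^sub>R norm (gradient f x) powr ((p1 - 2) / (p1 - 1))))
          - c2 *\<^sub>R (gradient f x /\<^sub>R norm (gradient f x) powr ((p2 - 2) / (p2 - 1))))"

text \<open>
  Classical solutions of an autonomous equation on a set \<open>J\<close> of times. The derivative is
  taken within \<open>J\<close>, so it is one-sided at endpoints belonging to \<open>J\<close>.
\<close>

definition ode_solution_on ::
    "('a::real_normed_vector \<Rightarrow> 'a) \<Rightarrow> real set \<Rightarrow> (real \<Rightarrow> 'a) \<Rightarrow> bool"
  where "ode_solution_on F J x \<longleftrightarrow>
    (\<forall>t\<in>J. (x has_vector_derivative F (x t)) (at t within J))"

end

theory Submission
  imports Defs "HOL-Complex_Analysis.Great_Picard"
begin

text \<open>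
  Write $F$ for the right-hand side and $z$ for the minimizer of $f$. Up to sign, $F$ is
  $c_1 N_{s_1}(\nabla f) + c_2 N_{s_2}(\nabla f)$ with $N_s(v) = \|v\|^s v$ and
  $s_i = -(p_i-2)/(p_i-1)$. Since $-1 < s_1 < 0 < s_2$, both maps $N_{s_i}$ are continuous, so $F$
  is continuous everywhere. But $N_{s_1}$ is not Lipschitz at $0$, so near $z$ the
  Picard-Lindeloef theorem need not apply. The proof uses three properties of $F$ only:
  continuity, the Lipschitz condition near every point other than $z$ (there $\nabla f \neq 0$, and
  $N_s$ is smooth away from $0$), and the dissipativity $\langle x - z, F(x)\rangle \le 0$. The
  latter holds because the tangent inequality of convex functions gives
  $\langle x - z, \nabla f(x)\rangle \ge f(x) - f(z) \ge 0$.
  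
  Dissipativity makes the distance to $z$ nonincreasing along solutions. This has two consequences.
  A solution cannot leave the ball around $z$ on which it starts, so cutting $F$ off outside that
  ball changes nothing, and a solution up to any time $T$ comes from Peano's theorem for bounded
  continuous fields. And a solution that reaches $z$ stays there; hence two solutions with the same
  initial value cannot separate: not at $z$ because both are stuck, and not elsewhere because of a
  Gronwall estimate. Uniqueness in turn glues the solutions on $[0,n]$ into a global one.
  
  Peano's theorem is proved with Tonelli's delayed equations $y'(t) = G(y(t-d))$, which are
  solved by iterated integration; a subsequence converges as $d \to 0$ by the Arzela-Ascoli theorem.
\<close>

section \<open>Peano's existence theorem for bounded continuous fields\<close>

text \<open>
  Picard iterates for $y'(t) = G(y(t-d))$ with $y = a$ before time $0$. Replacing $t - d$ by
  \<open>max 0 (t - d)\<close> encodes the constant history, so that only times $t \ge 0$ occur.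
\<close>

primrec delay_iterate :: "('a::euclidean_space \<Rightarrow> 'a) \<Rightarrow> real \<Rightarrow> 'a \<Rightarrow> nat \<Rightarrow> real \<Rightarrow> 'a" where
  "delay_iterate G d a 0 = (\<lambda>t. a)"
| "delay_iterate G d a (Suc k) =
    (\<lambda>t. a + integral {0..t} (\<lambda>s. G (delay_iterate G d a k (max 0 (s - d)))))"

lemma delay_iterate_at_0: "delay_iterate G d a k 0 = a"
  by (cases k) auto

lemma continuous_on_delayed:
  fixes G :: "'a::topological_space \<Rightarrow> 'b::topological_space"
  assumes "continuous_on UNIV G" "continuous_on {0..T} y" "0 \<le> d"
  shows "continuous_on {0..T} (\<lambda>s::real. G (y (max 0 (s - d))))"
  by (rule continuous_on_compose2[OF assms(1)])
     (auto intro!: continuous_intros continuous_on_compose2[OF assms(2)] simp: assms(3) diff_le_eq add_increasing2)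

lemma continuous_on_has_vector_derivative:
  assumes "\<And>t. t \<in> S \<Longrightarrow> (y has_vector_derivative D t) (at t within S)"
  shows "continuous_on S y"
  using assms has_vector_derivative_continuous continuous_on_eq_continuous_within by blast

lemma delay_iterate_has_vector_derivative:
  assumes "continuous_on UNIV G" "0 \<le> d" "continuous_on {0..T} (delay_iterate G d a k)" "t \<in> {0..T}"
  shows "(delay_iterate G d a (Suc k) has_vector_derivative
           G (delay_iterate G d a k (max 0 (t - d)))) (at t within {0..T})"
  using integral_has_vector_derivative[OF continuous_on_delayed[OF assms(1,3,2)] assms(4)]
  by (simp add: has_vector_derivative_add_const add.commute[of a])

lemma continuous_on_delay_iterate:
  assumes "continuous_on UNIV G" "0 \<le> d"
  shows "continuous_on {0..T} (delay_iterate G d a k)"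
proof (induction k)
  case (Suc k)
  show ?case
    using delay_iterate_has_vector_derivative[OF assms Suc]
    by (rule continuous_on_has_vector_derivative)
qed auto

text \<open>
  With a delay $d > 0$, values up to time $(k+1)d$ depend only on values up to time $kd$. So the
  iteration does not merely converge: the $k$-th iterate is already final on $[0,kd]$.
\<close>

lemma delay_iterate_stable:
  assumes "0 < d" "t \<le> real k * d"
  shows "delay_iterate G d a (Suc k) t = delay_iterate G d a k t"
  using assms(2)
proof (induction k arbitrary: t)
  case 0
  then show ?case by (cases "t = 0") auto
next
  case (Suc k)
  have "max 0 (s - d) \<le> real k * d" if "s \<in> {0..t}" for s
    using that Suc.prems assms(1) by (auto simp: algebra_simps)
  then have "integral {0..t} (\<lambda>s. G (delay_iterate G d a (Suc k) (max 0 (s - d)))) =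
        integral {0..t} (\<lambda>s. G (delay_iterate G d a k (max 0 (s - d))))"
    by (intro integral_cong) (simp only: Suc.IH)
  then show ?case
    by (simp only: delay_iterate.simps)
qed

lemma delay_solution_exists:
  fixes G :: "'a::euclidean_space \<Rightarrow> 'a"
  assumes "continuous_on UNIV G" "0 < d"
  obtains y where "y 0 = a"
    "\<And>t. t \<in> {0..T} \<Longrightarrow> (y has_vector_derivative G (y (max 0 (t - d)))) (at t within {0..T})"
proof -
  obtain k :: nat where k: "T < real k * d"
    using ex_less_of_nat_mult[OF assms(2)] by blast
  have "(delay_iterate G d a (Suc k) has_vector_derivative
          G (delay_iterate G d a (Suc k) (max 0 (t - d)))) (at t within {0..T})"
    if t: "t \<in> {0..T}" for t
  proof -
    have "max 0 (t - d) \<le> real k * d"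
      using t k assms(2) by auto
    then have "delay_iterate G d a (Suc k) (max 0 (t - d)) = delay_iterate G d a k (max 0 (t - d))"
      by (rule delay_iterate_stable[OF assms(2)])
    then show ?thesis
      using delay_iterate_has_vector_derivative[OF assms(1) _ continuous_on_delay_iterate t, of d a k] assms
      by simp
  qed
  then show ?thesis
    using that delay_iterate_at_0 by blast
qed

lemma vector_derivative_bound_imp_lipschitz:
  fixes y :: "real \<Rightarrow> 'a::real_normed_vector"
  assumes "\<And>t. t \<in> S \<Longrightarrow> (y has_vector_derivative D t) (at t within S)"
    and "\<And>t. t \<in> S \<Longrightarrow> norm (D t) \<le> M" and "convex S" "s \<in> S" "t \<in> S"
  shows "norm (y s - y t) \<le> M * \<bar>s - t\<bar>"
proof -
  have "norm (y s - y t) \<le> M * norm (s - t)"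
  proof (rule differentiable_bound[OF assms(3)])
    show "(y has_derivative (\<lambda>h. h *\<^sub>R D u)) (at u within S)" if "u \<in> S" for u
      using assms(1)[OF that] by (simp add: has_vector_derivative_def)
    show "onorm (\<lambda>h. h *\<^sub>R D u) \<le> M" if "u \<in> S" for u
      by (rule onorm_le) (use assms(2)[OF that] in \<open>simp add: mult.commute[of M] mult_left_mono\<close>)
  qed (use assms in auto)
  then show ?thesis by simp
qed

text \<open>
  The solutions $y_n$ of the equations with delay $d_n \to 0$ all have the Lipschitz constant $M$,
  so a subsequence converges uniformly to some $x$, and the delayed values converge to $x$ as well
  because the delay moves them by at most $M d_n$. Dominated convergence carries the integral
  equation over to $x$, and the integral equation makes $x$ differentiable.
\<close>

theorem Peano_bounded:
  fixes G :: "'a::euclidean_space \<Rightarrow> 'a"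
  assumes cont: "continuous_on UNIV G" and bound: "\<And>x. norm (G x) \<le> M"
  obtains x where "x 0 = a" "ode_solution_on G {0..T} x"
proof -
  define d where "d n = inverse (real (Suc n))" for n
  have d: "0 < d n" for n by (simp add: d_def)
  have "d \<longlonglongrightarrow> 0" unfolding d_def by (rule LIMSEQ_inverse_real_of_nat)
  have "\<forall>n. \<exists>y. y 0 = a \<and>
      (\<forall>t\<in>{0..T}. (y has_vector_derivative G (y (max 0 (t - d n)))) (at t within {0..T}))"
    using delay_solution_exists[OF cont d] by metis
  then obtain y where y0: "\<And>n. y n 0 = a" and
    y': "\<And>n t. t \<in> {0..T} \<Longrightarrow>
      (y n has_vector_derivative G (y n (max 0 (t - d n)))) (at t within {0..T})"
    by metis
  have M: "0 \<le> M" using bound[of a] norm_ge_zero order_trans by blast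
  have lip: "norm (y n s - y n t) \<le> M * \<bar>s - t\<bar>" if "s \<in> {0..T}" "t \<in> {0..T}" for n s t
    using y' bound convex_real_interval(5) that by (rule vector_derivative_bound_imp_lipschitz)
  have contn: "continuous_on {0..T} (y n)" for n
    using y' by (rule continuous_on_has_vector_derivative)
  have bdd: "norm (y n t) \<le> norm a + M * T" if "t \<in> {0..T}" for n t
  proof -
    have "norm (y n t - a) \<le> M * t"
      using lip[of t 0 n] that y0 by auto
    moreover have "M * t \<le> M * T"
      using that M by (auto intro: mult_left_mono)
    ultimately show ?thesis
      using norm_triangle_sub[of "y n t" a] by linarith
  qed
  have equi: "\<exists>r>0. \<forall>n t. t \<in> {0..T} \<and> norm (s - t) < r \<longrightarrow> norm (y n s - y n t) < e"
    if s: "s \<in> {0..T}" and e: "0 < e" for s e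
  proof (intro exI[of _ "e / (M + 1)"] conjI allI impI)
    show "0 < e / (M + 1)" using e M by simp
    fix n t assume t: "t \<in> {0..T} \<and> norm (s - t) < e / (M + 1)"
    have "norm (y n s - y n t) \<le> M * \<bar>s - t\<bar>" using lip s t by blast
    also have "\<dots> \<le> (M + 1) * \<bar>s - t\<bar>" by (intro mult_right_mono) auto
    also have "\<dots> < e" using t M by (simp add: field_simps)
    finally show "norm (y n s - y n t) < e" .
  qed
  obtain x k where x: "continuous_on {0..T} x" and k: "strict_mono (k :: nat \<Rightarrow> nat)" and
    unif: "\<And>e. 0 < e \<Longrightarrow> \<exists>N. \<forall>n t. n \<ge> N \<and> t \<in> {0..T} \<longrightarrow> norm (y (k n) t - x t) < e"
    by (rule Arzela_Ascoli[where \<F> = y, OF compact_Icc bdd equi]) blast+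
  have lim: "(\<lambda>n. y (k n) t) \<longlonglongrightarrow> x t" if "t \<in> {0..T}" for t
    unfolding LIMSEQ_iff using unif that by blast
  have dk: "(\<lambda>n. d (k n)) \<longlonglongrightarrow> 0"
    using LIMSEQ_subseq_LIMSEQ[OF \<open>d \<longlonglongrightarrow> 0\<close> k] by (simp add: o_def)
  have lim_delayed: "(\<lambda>n. y (k n) (max 0 (t - d (k n)))) \<longlonglongrightarrow> x t" if t: "t \<in> {0..T}" for t
  proof (rule Lim_transform2[OF lim[OF t]])
    have "(\<lambda>n. M * d (k n)) \<longlonglongrightarrow> 0"
      using tendsto_mult_right_zero[OF dk] .
    moreover have "norm (y (k n) t - y (k n) (max 0 (t - d (k n)))) \<le> M * d (k n)" for n
    proof -
      have "norm (y (k n) t - y (k n) (max 0 (t - d (k n)))) \<le> M * \<bar>t - max 0 (t - d (k n))\<bar>"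
        by (rule lip) (use t d[of "k n"] in auto)
      also have "\<dots> \<le> M * d (k n)"
        by (rule mult_left_mono) (use t d[of "k n"] M in auto)
      finally show ?thesis .
    qed
    ultimately show "(\<lambda>n. y (k n) t - y (k n) (max 0 (t - d (k n)))) \<longlonglongrightarrow> 0"
      by (rule Lim_null_comparison[OF always_eventually[OF allI], rotated])
  qed
  have eq: "x t = a + integral {0..t} (\<lambda>s. G (x s))" if t: "t \<in> {0..T}" for t
  proof -
    have sub: "{0..t} \<subseteq> {0..T}" using t by auto
    have int: "((\<lambda>s. G (y n (max 0 (s - d n)))) has_integral (y n t - a)) {0..t}" for n
    proof -
      have "((\<lambda>s. G (y n (max 0 (s - d n)))) has_integral (y n t - y n 0)) {0..t}"
      proof (rule fundamental_theorem_of_calculus)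
        show "(y n has_vector_derivative G (y n (max 0 (s - d n)))) (at s within {0..t})"
          if "s \<in> {0..t}" for s
          using that sub by (intro has_vector_derivative_within_subset[OF y' sub]) auto
      qed (use t in auto)
      then show ?thesis by (simp only: y0)
    qed
    have "(\<lambda>n. integral {0..t} (\<lambda>s. G (y (k n) (max 0 (s - d (k n))))))
        \<longlonglongrightarrow> integral {0..t} (\<lambda>s. G (x s))"
    proof (rule dominated_convergence)
      show "(\<lambda>s. G (y (k n) (max 0 (s - d (k n))))) integrable_on {0..t}" for n
        using int by blast
      show "(\<lambda>s. M) integrable_on {0..t}" by (rule integrable_const_ivl)
      show "(\<lambda>n. G (y (k n) (max 0 (s - d (k n))))) \<longlonglongrightarrow> G (x s)" if "s \<in> {0..t}" for s
        using continuous_on_tendsto_compose[OF cont lim_delayed[of s]] that sub by auto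
    qed (rule bound)
    then have "(\<lambda>n. y (k n) t - a) \<longlonglongrightarrow> integral {0..t} (\<lambda>s. G (x s))"
      using integral_unique[OF int] by simp
    moreover have "(\<lambda>n. y (k n) t - a) \<longlonglongrightarrow> x t - a"
      using lim[OF t] by (intro tendsto_intros)
    ultimately have "x t - a = integral {0..t} (\<lambda>s. G (x s))"
      using LIMSEQ_unique by blast
    then show ?thesis by (simp add: algebra_simps)
  qed
  \<comment> \<open>The limit is known on \<open>{0..T}\<close> only; this version also starts at \<open>a\<close> if \<open>T < 0\<close>.\<close>
  define X where "X t = a + integral {0..t} (\<lambda>s. G (x s))" for t
  have "(X has_vector_derivative G (x t)) (at t within {0..T})" if "t \<in> {0..T}" for t
    using integral_has_vector_derivative[OF continuous_on_compose2[OF cont x] that]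
    unfolding X_def by (simp add: has_vector_derivative_add_const add.commute[of a])
  then have "ode_solution_on G {0..T} X"
    using eq by (simp add: ode_solution_on_def X_def)
  moreover have "X 0 = a" by (simp add: X_def)
  ultimately show ?thesis using that by blast
qed

section \<open>Dissipative fields with one non-Lipschitz point\<close>

lemma ode_solution_on_subset:
  assumes "ode_solution_on F J x" "I \<subseteq> J"
  shows "ode_solution_on F I x"
  using assms unfolding ode_solution_on_def
  by (meson has_vector_derivative_within_subset subsetD)

lemma ode_solution_on_continuous:
  "ode_solution_on F J x \<Longrightarrow> continuous_on J x"
  unfolding ode_solution_on_def by (rule continuous_on_has_vector_derivative) blast

lemma ode_solution_on_interior:
  assumes "ode_solution_on F {a..b} x" "a < t" "t < b"
  shows "(x has_vector_derivative F (x t)) (at t)"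
proof -
  have "(x has_vector_derivative F (x t)) (at t within {a..b})"
    using assms by (auto simp: ode_solution_on_def)
  then show ?thesis by (simp add: at_within_Icc_at[OF assms(2,3)])
qed

text \<open>
  The squared distance $\|x(t)-z\|^2$ has derivative $2\langle x(t)-z, F(x(t))\rangle \le 0$.
\<close>

lemma dist_nonincreasing:
  fixes F :: "'a::real_inner \<Rightarrow> 'a"
  assumes sol: "ode_solution_on F {a..b} x" and "a \<le> b"
    and diss: "\<And>x. inner (x - z) (F x) \<le> 0"
  shows "dist z (x b) \<le> dist z (x a)"
proof -
  have "inner (x b - z) (x b - z) \<le> inner (x a - z) (x a - z)"
  proof (rule DERIV_nonpos_imp_decreasing_open[OF \<open>a \<le> b\<close>])
    show "continuous_on {a..b} (\<lambda>t. inner (x t - z) (x t - z))"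
      by (intro continuous_intros ode_solution_on_continuous[OF sol])
    fix t assume "a < t" "t < b"
    then have x': "(x has_vector_derivative F (x t)) (at t)"
      using ode_solution_on_interior[OF sol] by blast
    have "((\<lambda>t. inner (x t - z) (x t - z)) has_real_derivative 2 * inner (x t - z) (F (x t))) (at t)"
      unfolding has_field_derivative_def
      by (rule has_derivative_eq_rhs,
          (rule derivative_intros x'[unfolded has_vector_derivative_def])+)
         (auto simp: fun_eq_iff inner_commute algebra_simps)
    then show "\<exists>D. ((\<lambda>t. inner (x t - z) (x t - z)) has_real_derivative D) (at t) \<and> D \<le> 0"
      using diss[of "x t"] by fastforce
  qed
  then show ?thesis
    by (simp add: dist_norm norm_le norm_minus_commute[of z])
qed

text \<open>
  Gronwall's argument: $e^{-2Lt}\|x(t)-y(t)\|^2$ is nonincreasing and vanishes at the start.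
\<close>

lemma solutions_agree_of_lipschitz:
  fixes F :: "'a::real_inner \<Rightarrow> 'a"
  assumes x: "ode_solution_on F {a..b} x" and y: "ode_solution_on F {a..b} y"
    and "a \<le> b" and eq: "x a = y a" and L: "L-lipschitz_on S F"
    and S: "x ` {a..b} \<subseteq> S" "y ` {a..b} \<subseteq> S"
  shows "x b = y b"
proof -
  define V where "V t = exp (- 2 * L * t) * inner (x t - y t) (x t - y t)" for t
  have "V b \<le> V a"
  proof (rule DERIV_nonpos_imp_decreasing_open[OF \<open>a \<le> b\<close>])
    show "continuous_on {a..b} V"
      unfolding V_def
      by (intro continuous_intros ode_solution_on_continuous[OF x] ode_solution_on_continuous[OF y])
    fix t assume t: "a < t" "t < b"
    have x': "(x has_vector_derivative F (x t)) (at t)"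
      and y': "(y has_vector_derivative F (y t)) (at t)"
      using ode_solution_on_interior[OF x t] ode_solution_on_interior[OF y t] by auto
    have "inner (x t - y t) (F (x t) - F (y t)) \<le> norm (x t - y t) * norm (F (x t) - F (y t))"
      by (rule norm_cauchy_schwarz)
    also have "\<dots> \<le> norm (x t - y t) * (L * norm (x t - y t))"
      using S t by (intro mult_left_mono lipschitz_on_normD[OF L]) auto
    also have "\<dots> = L * inner (x t - y t) (x t - y t)"
      by (simp add: dot_square_norm power2_eq_square)
    finally have le: "inner (x t - y t) (F (x t) - F (y t)) \<le> L * inner (x t - y t) (x t - y t)" .
    have "(V has_real_derivative exp (- 2 * L * t) *
        (2 * inner (x t - y t) (F (x t) - F (y t)) - 2 * L * inner (x t - y t) (x t - y t))) (at t)"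
      unfolding has_field_derivative_def V_def
      by (rule has_derivative_eq_rhs,
          (rule derivative_intros x'[unfolded has_vector_derivative_def]
             y'[unfolded has_vector_derivative_def])+)
         (auto simp: fun_eq_iff inner_commute algebra_simps)
    moreover have "exp (- 2 * L * t) *
        (2 * inner (x t - y t) (F (x t) - F (y t)) - 2 * L * inner (x t - y t) (x t - y t)) \<le> 0"
      using le by (intro mult_nonneg_nonpos) auto
    ultimately show "\<exists>D. (V has_real_derivative D) (at t) \<and> D \<le> 0" by blast
  qed
  also have "V a = 0" by (simp add: V_def eq)
  finally have "inner (x b - y b) (x b - y b) \<le> 0"
    by (simp add: V_def mult_le_0_iff)
  then have "inner (x b - y b) (x b - y b) = 0"
    using inner_ge_zero by (rule antisym)
  then show ?thesis by simp
qed

text \<open>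
  The condition at a single point from which \<^const>\<open>locally_lipschitz\<close> is built. It is needed
  pointwise because the field may violate it at the minimizer, and only there.
\<close>

definition lipschitz_near :: "('a::metric_space \<Rightarrow> 'b::metric_space) \<Rightarrow> 'a \<Rightarrow> bool" where
  "lipschitz_near F x \<longleftrightarrow> (\<exists>r>0. \<exists>L. L-lipschitz_on (cball x r) F)"

text \<open>
  Consider the last time $s$ of agreement. If the common value is $z$, both solutions remain at $z$
  because their distance to $z$ cannot grow; otherwise the Lipschitz condition near that value
  prolongs the agreement beyond $s$. Backward uniqueness fails in general, since solutions may reach
  $z$ in finite time.
\<close>

lemma forward_unique:
  fixes F :: "'a::real_inner \<Rightarrow> 'a"
  assumes diss: "\<And>x. inner (x - z) (F x) \<le> 0"
    and lip: "\<And>x. x \<noteq> z \<Longrightarrow> lipschitz_near F x"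
    and x: "ode_solution_on F {0..T} x" and y: "ode_solution_on F {0..T} y"
    and eq: "x 0 = y 0" and T: "0 \<le> T"
  shows "x T = y T"
proof (rule ccontr)
  assume neq: "x T \<noteq> y T"
  define E where "E = {t \<in> {0..T}. x t - y t = 0}"
  define s where "s = Sup E"
  have cx: "continuous_on {0..T} x" and cy: "continuous_on {0..T} y"
    using x y ode_solution_on_continuous by auto
  have "closed E"
    unfolding E_def
    by (rule continuous_closed_preimage_constant)
       (intro continuous_intros cx cy closed_atLeastAtMost)+
  moreover have "E \<noteq> {}" using eq T by (auto simp: E_def)
  moreover have bdd: "bdd_above E" unfolding E_def by (auto intro!: bdd_aboveI[of _ T])
  ultimately have "s \<in> E" unfolding s_def by (intro closed_contains_Sup)
  then have s: "0 \<le> s" "s \<le> T" and xys: "x s = y s" by (auto simp: E_def)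
  have last: "t \<le> s" if "t \<in> E" for t
    unfolding s_def by (rule cSup_upper[OF that bdd])
  have "s < T" using s neq xys by (metis le_less)
  show False
  proof (cases "x s = z")
    case True
    have "dist z (x T) \<le> dist z (x s)"
      by (rule dist_nonincreasing[OF ode_solution_on_subset[OF x] s(2) diss]) (use s in auto)
    moreover have "dist z (y T) \<le> dist z (y s)"
      by (rule dist_nonincreasing[OF ode_solution_on_subset[OF y] s(2) diss]) (use s in auto)
    ultimately show False using True xys neq by simp
  next
    case False
    then obtain r L where r: "r > 0" and L: "L-lipschitz_on (cball (x s) r) F"
      using lip unfolding lipschitz_near_def by blast
    obtain d1 where d1: "d1 > 0" "\<And>t. t \<in> {0..T} \<Longrightarrow> dist t s < d1 \<Longrightarrow> dist (x t) (x s) < r"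
      using cx r s unfolding continuous_on_iff by (metis atLeastAtMost_iff)
    obtain d2 where d2: "d2 > 0" "\<And>t. t \<in> {0..T} \<Longrightarrow> dist t s < d2 \<Longrightarrow> dist (y t) (y s) < r"
      using cy r s unfolding continuous_on_iff by (metis atLeastAtMost_iff)
    define b where "b = min T (s + min d1 d2 / 2)"
    have b: "s < b" "b \<le> T" "b < s + d1" "b < s + d2"
      using \<open>s < T\<close> d1(1) d2(1) by (auto simp: b_def min_def)
    have "x b = y b"
    proof (rule solutions_agree_of_lipschitz[where F = F and L = L and S = "cball (x s) r"])
      show "ode_solution_on F {s..b} x" "ode_solution_on F {s..b} y"
        using ode_solution_on_subset[OF x] ode_solution_on_subset[OF y] s b by auto
      show "x ` {s..b} \<subseteq> cball (x s) r"
      proof clarify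
        fix t assume "t \<in> {s..b}"
        then have "dist (x t) (x s) < r" using s b by (intro d1) (auto simp: dist_real_def)
        then show "x t \<in> cball (x s) r" by (simp add: dist_commute)
      qed
      show "y ` {s..b} \<subseteq> cball (x s) r"
      proof clarify
        fix t assume "t \<in> {s..b}"
        then have "dist (y t) (y s) < r" using s b by (intro d2) (auto simp: dist_real_def)
        then show "y t \<in> cball (x s) r" by (simp add: xys dist_commute)
      qed
    qed (use b xys L in auto)
    then have "b \<in> E" using b s by (auto simp: E_def)
    then show False using last b by fastforce
  qed
qed

text \<open>
  The field is multiplied with a cutoff that is $1$ on the ball of radius $\|a - z\|$ around $z$ and
  $0$ outside a larger one. The product is bounded and still dissipative, so its solutions from $a$
  never leave the smaller ball, where it coincides with $F$.
\<close>

lemma dissipative_solution_exists: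
  fixes F :: "'a::euclidean_space \<Rightarrow> 'a"
  assumes cont: "continuous_on UNIV F" and diss: "\<And>x. inner (x - z) (F x) \<le> 0"
  obtains x where "x 0 = a" "ode_solution_on F {0..T} x"
proof -
  define R where "R = dist z a"
  define \<eta> where "\<eta> x = max 0 (min 1 (R + 1 - dist z x))" for x
  define G where "G x = \<eta> x *\<^sub>R F x" for x
  have \<eta>: "0 \<le> \<eta> x" "\<eta> x \<le> 1" for x by (auto simp: \<eta>_def)
  have contG: "continuous_on UNIV G"
    unfolding G_def \<eta>_def by (intro continuous_intros cont)
  have "compact (F ` cball z (R + 1))"
    by (intro compact_continuous_image continuous_on_subset[OF cont]) auto
  then obtain M where M: "\<And>x. x \<in> cball z (R + 1) \<Longrightarrow> norm (F x) \<le> M" "M > 0"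
    using compact_imp_bounded bounded_pos by (metis imageI)
  have bound: "norm (G x) \<le> M" for x
  proof (cases "x \<in> cball z (R + 1)")
    case True
    then have "norm (G x) \<le> 1 * M"
      unfolding G_def norm_scaleR using \<eta>[of x] M by (intro mult_mono) auto
    then show ?thesis by simp
  next
    case False
    then have "\<eta> x = 0" by (auto simp: \<eta>_def)
    then show ?thesis using M(2) by (simp add: G_def)
  qed
  obtain x where x: "x 0 = a" "ode_solution_on G {0..T} x"
    using Peano_bounded[OF contG bound] by blast
  have "inner (w - z) (G w) \<le> 0" for w
    using diss[of w] \<eta>[of w] by (simp add: G_def mult_nonneg_nonpos)
  then have "dist z (x t) \<le> R" if "t \<in> {0..T}" for t
    unfolding R_def x(1)[symmetric]
    by (intro dist_nonincreasing[OF ode_solution_on_subset[OF x(2)]]) (use that in auto)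
  then have "G (x t) = F (x t)" if "t \<in> {0..T}" for t
    using that by (simp add: G_def \<eta>_def)
  then have "ode_solution_on F {0..T} x"
    using x(2) by (simp add: ode_solution_on_def)
  then show ?thesis using that x by blast
qed

theorem dissipative_well_posed:
  fixes F :: "'a::euclidean_space \<Rightarrow> 'a"
  assumes cont: "continuous_on UNIV F" and diss: "\<And>x. inner (x - z) (F x) \<le> 0"
    and lip: "\<And>x. x \<noteq> z \<Longrightarrow> lipschitz_near F x"
  shows "\<exists>x. ode_solution_on F {0..} x \<and> x 0 = a \<and>
    (\<forall>J y. is_interval J \<and> 0 \<in> J \<and> J \<subseteq> {0..} \<and> ode_solution_on F J y \<and> y 0 = a \<longrightarrow>
           (\<forall>t\<in>J. y t = x t))"
proof -
  have "\<forall>n::nat. \<exists>x. x 0 = a \<and> ode_solution_on F {0..real n} x"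
  proof
    show "\<exists>x. x 0 = a \<and> ode_solution_on F {0..real n} x" for n
      by (rule dissipative_solution_exists[OF cont diss, of a "real n"]) blast
  qed
  then obtain X where X0: "\<And>n. X n 0 = a" and X: "\<And>n::nat. ode_solution_on F {0..real n} (X n)"
    by metis
  \<comment> \<open>By uniqueness the solutions on longer intervals extend each other, so any choice of
    index \<open>n \<ge> t\<close> gives the same value at time \<open>t\<close>.\<close>
  define x where "x t = X (nat \<lceil>t\<rceil>) t" for t
  have xX: "x t = X n t" if "0 \<le> t" "t \<le> real n" for t n
    unfolding x_def
    by (rule forward_unique[OF diss lip ode_solution_on_subset[OF X] ode_solution_on_subset[OF X]])
       (use that X0 in auto)
  have sol: "ode_solution_on F {0..} x"
    unfolding ode_solution_on_def
  proof
    fix t :: real assume t: "t \<in> {0..}"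
    obtain n :: nat where n: "t < real n" using reals_Archimedean2 by blast
    have "(X n has_vector_derivative F (X n t)) (at t within {0..real n})"
      using X[of n] t n by (auto simp: ode_solution_on_def)
    then have "(x has_vector_derivative F (X n t)) (at t within {0..real n})"
    proof (rule has_vector_derivative_transform[rotated 2])
      show "x s = X n s" if "s \<in> {0..real n}" for s
        using that by (intro xX) auto
    qed (use t n in auto)
    then have "(x has_vector_derivative F (x t)) (at t within {0..real n})"
      using xX[of t n] t n by (simp only: atLeast_iff less_imp_le)
    \<comment> \<open>As \<open>t < n\<close>, the right end of the interval is away from \<open>t\<close>.\<close>
    moreover have "at t within {0..real n} = at t within {0..}"
      by (rule at_within_nhd[of _ "{..<real n}"]) (use n in auto)
    ultimately show "(x has_vector_derivative F (x t)) (at t within {0..})" by simp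
  qed
  have "y t = x t" if J: "is_interval J" "0 \<in> J" "J \<subseteq> {0..}" and y: "ode_solution_on F J y" "y 0 = a"
    and t: "t \<in> J" for J y t
  proof (rule forward_unique[OF diss lip])
    have "{0..t} \<subseteq> J"
      using J t mem_is_interval_1_I[of J 0 t] by auto
    then show "ode_solution_on F {0..t} y"
      using y(1) ode_solution_on_subset by blast
    show "ode_solution_on F {0..t} x"
      using sol by (rule ode_solution_on_subset) auto
    show "y 0 = x 0" using y X0 by (simp add: x_def)
    show "0 \<le> t" using J t by auto
  qed
  moreover have "x 0 = a" using X0 by (simp add: x_def)
  ultimately show ?thesis using sol by blast
qed

section \<open>Closure properties of the Lipschitz condition at a point\<close>

lemma lipschitz_near_compose:
  assumes g: "lipschitz_near g x" and h: "lipschitz_near h (g x)"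
  shows "lipschitz_near (\<lambda>x. h (g x)) x"
proof -
  obtain r L where r: "r > 0" and L: "L-lipschitz_on (cball x r) g"
    using g unfolding lipschitz_near_def by blast
  obtain q K where q: "q > 0" and K: "K-lipschitz_on (cball (g x) q) h"
    using h unfolding lipschitz_near_def by blast
  have L0: "0 \<le> L" using L by (rule lipschitz_on_nonneg)
  define p where "p = min r (q / (L + 1))"
  have p: "0 < p" "p \<le> r" "p \<le> q / (L + 1)" using r q L0 by (auto simp: p_def)
  have Lp: "L-lipschitz_on (cball x p) g" using p by (intro lipschitz_on_subset[OF L] subset_cball)
  have "g ` cball x p \<subseteq> cball (g x) q"
  proof clarify
    fix w assume w: "w \<in> cball x p"
    have "dist (g x) (g w) \<le> L * dist x w"
      using lipschitz_onD[OF Lp _ w] p by auto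
    also have "\<dots> \<le> (L + 1) * p" using w L0 p by (intro mult_mono) auto
    also have "\<dots> \<le> q" using p L0 by (simp add: field_simps)
    finally show "g w \<in> cball (g x) q" by simp
  qed
  then have "(K * L)-lipschitz_on (cball x p) (\<lambda>x. h (g x))"
    using lipschitz_on_compose2[OF Lp lipschitz_on_subset[OF K]] by simp
  then show ?thesis using p unfolding lipschitz_near_def by blast
qed

lemma lipschitz_near_diff:
  fixes g h :: "'a::metric_space \<Rightarrow> 'b::real_normed_vector"
  assumes g: "lipschitz_near g x" and h: "lipschitz_near h x"
  shows "lipschitz_near (\<lambda>x. g x - h x) x"
proof -
  obtain r L where r: "r > 0" and L: "L-lipschitz_on (cball x r) g"
    using g unfolding lipschitz_near_def by blast
  obtain q K where q: "q > 0" and K: "K-lipschitz_on (cball x q) h"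
    using h unfolding lipschitz_near_def by blast
  have "(L + K)-lipschitz_on (cball x (min r q)) (\<lambda>x. g x - h x)"
    by (intro lipschitz_on_diff lipschitz_on_subset[OF L] lipschitz_on_subset[OF K] subset_cball) auto
  then show ?thesis using r q unfolding lipschitz_near_def by (metis min_less_iff_conj)
qed

lemma lipschitz_near_scaleR:
  fixes g :: "'a::metric_space \<Rightarrow> 'b::real_normed_vector"
  assumes "lipschitz_near g x"
  shows "lipschitz_near (\<lambda>x. c *\<^sub>R g x) x"
  using assms lipschitz_on_cmult unfolding lipschitz_near_def by blast

section \<open>Radial power maps\<close>

definition radial_power :: "real \<Rightarrow> 'a::real_normed_vector \<Rightarrow> 'a" where
  "radial_power s v = (norm v powr s) *\<^sub>R v"

text \<open>
  Only the origin needs an argument, where the norm of the value is $\|v\|^{1+s}$ with positive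
  exponent.
\<close>

lemma isCont_radial_power:
  fixes v :: "'a::real_normed_vector"
  assumes s: "-1 < s"
  shows "isCont (radial_power s) v"
proof (cases "v = 0")
  case False
  then show ?thesis unfolding radial_power_def by (intro continuous_intros) auto
next
  case True
  have "((\<lambda>w::'a. norm w powr (1 + s)) \<longlongrightarrow> 0) (at 0)"
  proof (rule tendsto_eq_rhs[OF tendsto_powr'])
    show "(norm \<longlongrightarrow> norm (0::'a)) (at (0::'a))" by (rule tendsto_norm[OF tendsto_ident_at])
    show "((\<lambda>w::'a. 1 + s) \<longlongrightarrow> 1 + s) (at 0)" by (intro tendsto_intros)
  qed (use s in auto)
  moreover have "norm (radial_power s w) \<le> norm w powr (1 + s)" for w :: 'a
    by (cases "w = 0") (auto simp: radial_power_def powr_add)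
  ultimately have "(radial_power s \<longlongrightarrow> (0::'a)) (at 0)"
    by (rule Lim_null_comparison[OF always_eventually[OF allI], rotated])
  then show ?thesis using True by (simp add: isCont_def radial_power_def[of s 0])
qed

text \<open>
  On the ball of radius $m = \|v\|/2$ around $v$ the norm ranges over $[m, 3m]$, away from $0$. There
  $r \mapsto r^s$ is bounded and Lipschitz, and so is its product with the identity.
\<close>

lemma lipschitz_near_radial_power:
  fixes v :: "'a::real_normed_vector"
  assumes "v \<noteq> 0"
  shows "lipschitz_near (radial_power s) v"
proof -
  define m where "m = norm v / 2"
  define I where "I = {m..3 * m}"
  have m: "0 < m" using assms by (simp add: m_def)
  have I: "norm w \<in> I" if "w \<in> cball v m" for w
  proof -
    have "norm (v - w) \<le> m" using that by (simp add: dist_norm)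
    then show ?thesis
      using norm_triangle_ineq2[of v w] norm_triangle_ineq2[of w v]
      by (simp add: I_def m_def norm_minus_commute[of w v])
  qed
  have "continuous_on I (\<lambda>r. s * r powr (s - 1))" "continuous_on I (\<lambda>r. r powr s)"
    unfolding I_def using m by (auto intro!: continuous_intros)
  then have "bounded ((\<lambda>r. s * r powr (s - 1)) ` I)" "bounded ((\<lambda>r. r powr s) ` I)"
    unfolding I_def by (blast intro: compact_imp_bounded compact_continuous_image compact_Icc)+
  then obtain A B where A: "\<And>r. r \<in> I \<Longrightarrow> \<bar>s * r powr (s - 1)\<bar> \<le> A"
    and B: "\<And>r. r \<in> I \<Longrightarrow> \<bar>r powr s\<bar> \<le> B"
    unfolding bounded_iff by (metis imageI real_norm_def)
  have mI: "m \<in> I" using m by (simp add: I_def)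
  have A0: "0 \<le> A" and B0: "0 \<le> B" using A[OF mI] B[OF mI] by linarith+
  have powr_lip: "\<bar>p powr s - q powr s\<bar> \<le> A * \<bar>p - q\<bar>" if "p \<in> I" "q \<in> I" for p q
  proof -
    have "norm (p powr s - q powr s) \<le> A * norm (p - q)"
    proof (rule field_differentiable_bound[of I _ "\<lambda>r. s * r powr (s - 1)"])
      show "convex I" by (simp add: I_def)
      show "((\<lambda>r. r powr s) has_field_derivative s * r powr (s - 1)) (at r within I)" if "r \<in> I" for r
        by (rule has_field_derivative_at_within[OF has_real_derivative_powr])
           (use that m in \<open>auto simp: I_def\<close>)
    qed (use A that in auto)
    then show ?thesis by simp
  qed
  have "(A * (3 * m) + B)-lipschitz_on (cball v m) (radial_power s)"
  proof (rule lipschitz_onI)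
    fix w u assume wu: "w \<in> cball v m" "u \<in> cball v m"
    have "dist (radial_power s w) (radial_power s u)
        = norm ((norm w powr s - norm u powr s) *\<^sub>R w + (norm u powr s) *\<^sub>R (w - u))"
      by (simp add: radial_power_def dist_norm algebra_simps)
    also have "\<dots> \<le> \<bar>norm w powr s - norm u powr s\<bar> * norm w + \<bar>norm u powr s\<bar> * norm (w - u)"
      by (rule norm_triangle_le) simp
    also have "\<dots> \<le> (A * norm (w - u)) * (3 * m) + B * norm (w - u)"
    proof (intro add_mono mult_mono)
      have "\<bar>norm w powr s - norm u powr s\<bar> \<le> A * \<bar>norm w - norm u\<bar>"
        using powr_lip I wu by blast
      also have "\<dots> \<le> A * norm (w - u)"
        using A0 norm_triangle_ineq3 by (intro mult_left_mono)
      finally show "\<bar>norm w powr s - norm u powr s\<bar> \<le> A * norm (w - u)" .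
      show "norm w \<le> 3 * m" using I[OF wu(1)] by (simp add: I_def)
      show "\<bar>norm u powr s\<bar> \<le> B" using B I wu by blast
    qed (use A0 B0 in auto)
    finally show "dist (radial_power s w) (radial_power s u) \<le> (A * (3 * m) + B) * dist w u"
      by (simp add: dist_norm algebra_simps)
  qed (use A0 B0 m in auto)
  then show ?thesis using m unfolding lipschitz_near_def by blast
qed

section \<open>Gradients of convex functions\<close>

text \<open>
  The gradient is defined by a description, so both existence (the representation of the derivative
  as an inner product) and uniqueness are due.
\<close>

lemma differentiable_imp_GDERIV_gradient:
  fixes f :: "'a::euclidean_space \<Rightarrow> real"
  assumes "f differentiable at x"
  shows "GDERIV f x :> gradient f x"
proof -
  obtain D where D: "(f has_derivative D) (at x)"
    using assms unfolding differentiable_def by blast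
  define d where "d = (\<Sum>b\<in>Basis. D b *\<^sub>R b)"
  have "D = (\<lambda>h. inner h d)"
  proof
    fix h
    have "D h = D (\<Sum>b\<in>Basis. inner h b *\<^sub>R b)" by (simp add: euclidean_representation)
    also have "\<dots> = inner h d"
      using has_derivative_linear[OF D]
      by (simp add: linear_sum linear_scale d_def inner_sum_right mult.commute)
    finally show "D h = inner h d" .
  qed
  then have "GDERIV f x :> d"
    using D by (simp add: gderiv_def)
  then show ?thesis
    unfolding gradient_def
  proof (rule theI)
    fix e assume "GDERIV f x :> e"
    then have "(\<lambda>h. inner h e) = (\<lambda>h. inner h d)"
      using \<open>GDERIV f x :> d\<close> has_derivative_unique unfolding gderiv_def by blast
    then show "e = d"
      by (metis inner_commute vector_eq_ldot)
  qed
qed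

text \<open>
  The one-dimensional tangent inequality, applied along the segment from \<open>x\<close> to \<open>y\<close>.
\<close>

lemma convex_above_tangent_gradient:
  fixes f :: "'a::real_inner \<Rightarrow> real"
  assumes conv: "convex_on UNIV f" and g: "GDERIV f x :> g"
  shows "f x + inner (y - x) g \<le> f y"
proof -
  define \<phi> where "\<phi> t = f (x + t *\<^sub>R (y - x))" for t
  have "convex_on UNIV \<phi>"
  proof (rule convex_onI)
    fix t p q :: real assume t: "0 < t" "t < 1"
    have "x + ((1 - t) *\<^sub>R p + t *\<^sub>R q) *\<^sub>R (y - x)
        = (1 - t) *\<^sub>R (x + p *\<^sub>R (y - x)) + t *\<^sub>R (x + q *\<^sub>R (y - x))"
      by (simp add: algebra_simps)
    then show "\<phi> ((1 - t) *\<^sub>R p + t *\<^sub>R q) \<le> (1 - t) * \<phi> p + t * \<phi> q"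
      unfolding \<phi>_def using convex_onD[OF conv, of t] t by simp
  qed simp
  moreover have "(\<phi> has_real_derivative inner (y - x) g) (at 0)"
  proof -
    have "(f has_derivative (\<lambda>h. inner h g)) (at (x + 0 *\<^sub>R (y - x)))"
      using g by (simp add: gderiv_def)
    moreover have "((\<lambda>t. x + t *\<^sub>R (y - x)) has_derivative (\<lambda>h. h *\<^sub>R (y - x))) (at 0)"
      by (auto intro!: derivative_eq_intros)
    ultimately have "(\<phi> has_derivative (\<lambda>h. inner (h *\<^sub>R (y - x)) g)) (at 0)"
      unfolding \<phi>_def by (rule has_derivative_compose[rotated])
    moreover have "(\<lambda>h. inner (h *\<^sub>R (y - x)) g) = (*) (inner (y - x) g)"
      by (simp add: fun_eq_iff mult.commute)
    ultimately show ?thesis by (simp add: has_field_derivative_def)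
  qed
  ultimately have "\<phi> 1 - \<phi> 0 \<ge> inner (y - x) g * (1 - 0)"
    by (intro convex_on_imp_above_tangent[where A = UNIV]) auto
  then show ?thesis by (simp add: \<phi>_def)
qed

section \<open>Well-posedness of the flow\<close>

text \<open>
  Radial powers vanish at $0$, so the convention at critical points of \<open>f\<close> is covered by the same
  formula.
\<close>

lemma flow_rhs_eq_radial_power:
  "flow_rhs f c1 c2 p1 p2 x =
    (- c1) *\<^sub>R radial_power (- ((p1 - 2) / (p1 - 1))) (gradient f x)
    - c2 *\<^sub>R radial_power (- ((p2 - 2) / (p2 - 1))) (gradient f x)"
  by (simp add: flow_rhs_def radial_power_def powr_minus del: minus_divide_left minus_diff_eq)

theorem proposition1:
  fixes f :: "real ^ 'n \<Rightarrow> real" and c1 c2 p1 p2 :: real and x0 :: "real ^ 'n"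
  assumes "C11_loc f"
    and "convex_on UNIV f"
    and "\<exists>!z. \<forall>y. f z \<le> f y"
    and "c1 > 0" and "c2 > 0"
    and "p1 > 2" and "1 < p2" and "p2 < 2"
  shows "\<exists>x. ode_solution_on (flow_rhs f c1 c2 p1 p2) {0..} x \<and> x 0 = x0 \<and>
    (\<forall>J y. is_interval J \<and> 0 \<in> J \<and> J \<subseteq> {0..} \<and>
           ode_solution_on (flow_rhs f c1 c2 p1 p2) J y \<and> y 0 = x0 \<longrightarrow>
           (\<forall>t\<in>J. y t = x t))"
proof -
  define s1 where "s1 = - ((p1 - 2) / (p1 - 1))"
  define s2 where "s2 = - ((p2 - 2) / (p2 - 1))"
  have s: "-1 < s1" "-1 < s2"
    using assms by (auto simp: s1_def s2_def field_simps)
  define F where "F = flow_rhs f c1 c2 p1 p2"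
  have F: "F x = (- c1) *\<^sub>R radial_power s1 (gradient f x) - c2 *\<^sub>R radial_power s2 (gradient f x)" for x
    by (simp only: F_def s1_def s2_def flow_rhs_eq_radial_power)
  obtain z where z: "\<And>y. f z \<le> f y" and z_unique: "\<And>w. (\<And>y. f w \<le> f y) \<Longrightarrow> w = z"
    using assms(3) by metis
  have tangent: "f x + inner (y - x) (gradient f x) \<le> f y" for x y
    using assms(1) unfolding C11_loc_def
    by (intro convex_above_tangent_gradient assms(2) differentiable_imp_GDERIV_gradient) auto
  \<comment> \<open>By the tangent inequality a critical point is a minimizer, so \<open>z\<close> is the only one.\<close>
  have grad_nz: "gradient f x \<noteq> 0" if "x \<noteq> z" for x
    using tangent[of x] z_unique[of x] that by fastforce
  have cont: "continuous_on UNIV F"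
  proof -
    have "continuous_on UNIV (\<lambda>x. radial_power r (gradient f x))" if "-1 < r" for r
      by (rule continuous_on_compose2[of UNIV])
         (use assms(1) isCont_radial_power[OF that] in
           \<open>auto simp: C11_loc_def intro: continuous_at_imp_continuous_on\<close>)
    then show ?thesis
      using s by (auto simp: F[abs_def] intro!: continuous_intros)
  qed
  have diss: "inner (x - z) (F x) \<le> 0" for x
  proof -
    have "inner (x - z) (gradient f x) \<ge> 0"
      using tangent[of x z] z[of x] by (simp add: inner_diff_left)
    moreover have "inner (x - z) (F x) = - (inner (x - z) (gradient f x) *
        (c1 * norm (gradient f x) powr s1 + c2 * norm (gradient f x) powr s2))"
      by (simp add: F radial_power_def inner_diff_right algebra_simps)
    ultimately show ?thesis
      using assms(4,5) by simp
  qed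
  have lip: "lipschitz_near F x" if "x \<noteq> z" for x
  proof -
    have "lipschitz_near (gradient f) x"
      using assms(1) by (auto simp: C11_loc_def locally_lipschitz_def lipschitz_near_def)
    then show ?thesis
      unfolding F[abs_def]
      by (intro lipschitz_near_diff lipschitz_near_scaleR lipschitz_near_radial_power
          grad_nz[OF that] lipschitz_near_compose[of "gradient f" x "radial_power _"])
  qed
  show ?thesis
    using dissipative_well_posed[OF cont diss lip] unfolding F_def by blast
qed

end
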